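(* Let $S$ be a semiring, $M$ a left $S$-semimodule and $\{J_\lambda\}_{\lambda\in\Lambda}$ a collection of left $S$-semimodules. Then $\prod_{\lambda\in\Lambda}J_\lambda$ is $M$-$e$-injective if and only if $J_\lambda$ is $M$-$e$-injective for every $\lambda\in\Lambda$.
   Context: A semiring $(S,+,0,\cdot,1)$ consists of a commutative monoid $(S,+,0)$ and a monoid $(S,\cdot,1)$ with $0\neq 1$, $a0=0=0a$, and both distributive laws. A left $S$-semimodule is a commutative monoid with a unital action of $S$ satisfying the usual module axioms, including $0m=0$ and $s0=0$ (no additive inverses required). Products are taken with componentwise operations. For an $S$-linear map $f:L\to M$ let $\mathrm{Ker}(f)=\{l\in L\mid f(l)=0\}$. The map $f$ is $k$-normal if whenever $f(l)=f(l')$ with $l,l'\in L$, there are $k,k'\in \mathrm{Ker}(f)$ with $l+k=l'+k'$. A sequence $L\xrightarrow{f}M\xrightarrow{g}N$ is exact if $f(L)=\mathrm{Ker}(g)$ and $g$ is $k$-normal; a longer sequence is exact if each three-term part is exact. The same definitions apply to commutative monoids, viewed as semimodules over $\mathbb{Z}^{+}$ (the non-negative integers). A left $S$-semimodule $J$ is $M$-$e$-injective if for every short exact sequence $0\to L\xrightarrow{f}M\xrightarrow{g}N\to 0$ of left $S$-semimodules (with middle term $M$) the induced sequence of commutative monoids $0\to \mathrm{Hom}_S(N,J)\to \mathrm{Hom}_S(M,J)\to \mathrm{Hom}_S(L,J)\to 0$ is exact. *)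

theory Defs
  imports "HOL-Algebra.AbelCoset" "HOL-Algebra.Module"
begin

section \<open>Left semimodules over a semiring\<close>

text \<open>
  The library locale \<^locale>\<open>semiring\<close> does not require \<open>\<zero> \<noteq> \<one>\<close>; this is a separate hypothesis
  wherever it is needed.  Commutative monoids are additive, i.e. \<^locale>\<open>abelian_monoid\<close>.
  In the records for semimodules and for commutative monoids the fields \<open>mult\<close> and
  \<open>one\<close>, inherited from the library's record hierarchy, carry no meaning and are left undefined.
\<close>

locale semimodule = S?: semiring S + M?: abelian_monoid M for S (structure) and M (structure) +
  assumes smult_closed:
      "\<lbrakk> a \<in> carrier S; x \<in> carrier M \<rbrakk> \<Longrightarrow> a \<odot>\<^bsub>M\<^esub> x \<in> carrier M"
    and smult_l_distr:
      "\<lbrakk> a \<in> carrier S; b \<in> carrier S; x \<in> carrier M \<rbrakk> \<Longrightarrow>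
        (a \<oplus> b) \<odot>\<^bsub>M\<^esub> x = a \<odot>\<^bsub>M\<^esub> x \<oplus>\<^bsub>M\<^esub> b \<odot>\<^bsub>M\<^esub> x"
    and smult_r_distr:
      "\<lbrakk> a \<in> carrier S; x \<in> carrier M; y \<in> carrier M \<rbrakk> \<Longrightarrow>
        a \<odot>\<^bsub>M\<^esub> (x \<oplus>\<^bsub>M\<^esub> y) = a \<odot>\<^bsub>M\<^esub> x \<oplus>\<^bsub>M\<^esub> a \<odot>\<^bsub>M\<^esub> y"
    and smult_assoc:
      "\<lbrakk> a \<in> carrier S; b \<in> carrier S; x \<in> carrier M \<rbrakk> \<Longrightarrow>
        (a \<otimes> b) \<odot>\<^bsub>M\<^esub> x = a \<odot>\<^bsub>M\<^esub> (b \<odot>\<^bsub>M\<^esub> x)"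
    and smult_one: "x \<in> carrier M \<Longrightarrow> \<one> \<odot>\<^bsub>M\<^esub> x = x"
    and zero_smult: "x \<in> carrier M \<Longrightarrow> \<zero> \<odot>\<^bsub>M\<^esub> x = \<zero>\<^bsub>M\<^esub>"
    and smult_zero: "a \<in> carrier S \<Longrightarrow> a \<odot>\<^bsub>M\<^esub> \<zero>\<^bsub>M\<^esub> = \<zero>\<^bsub>M\<^esub>"

definition linear_maps ::
    "('s, 'a) ring_scheme \<Rightarrow> ('s, 'm, 'b) module_scheme \<Rightarrow> ('s, 'n, 'c) module_scheme \<Rightarrow> ('m \<Rightarrow> 'n) set"
  where "linear_maps S M N =
    {f \<in> carrier M \<rightarrow> carrier N.
       (\<forall>x\<in>carrier M. \<forall>y\<in>carrier M. f (x \<oplus>\<^bsub>M\<^esub> y) = f x \<oplus>\<^bsub>N\<^esub> f y) \<and>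
       (\<forall>s\<in>carrier S. \<forall>x\<in>carrier M. f (s \<odot>\<^bsub>M\<^esub> x) = s \<odot>\<^bsub>N\<^esub> f x)}"

definition prod_semimodule :: "'i set \<Rightarrow> ('i \<Rightarrow> ('s, 'j, 'b) module_scheme) \<Rightarrow> ('s, 'i \<Rightarrow> 'j) module"
  where "prod_semimodule \<Lambda> J =
    \<lparr> carrier = (\<Pi>\<^sub>E i\<in>\<Lambda>. carrier (J i)),
      mult = undefined, one = undefined,
      zero = (\<lambda>i\<in>\<Lambda>. \<zero>\<^bsub>J i\<^esub>),
      add = (\<lambda>x y. \<lambda>i\<in>\<Lambda>. x i \<oplus>\<^bsub>J i\<^esub> y i),
      smult = (\<lambda>s x. \<lambda>i\<in>\<Lambda>. s \<odot>\<^bsub>J i\<^esub> x i) \<rparr>"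

text \<open>
  Elements of a Hom monoid are linear maps made extensional on the carrier of the domain, so that
  equality in the monoid is equality as maps on that carrier.
\<close>

definition Hom_monoid ::
    "('s, 'a) ring_scheme \<Rightarrow> ('s, 'm, 'b) module_scheme \<Rightarrow> ('s, 'n, 'c) module_scheme \<Rightarrow> ('m \<Rightarrow> 'n) ring"
  where "Hom_monoid S M N =
    \<lparr> carrier = linear_maps S M N \<inter> extensional (carrier M),
      mult = undefined, one = undefined,
      zero = (\<lambda>x\<in>carrier M. \<zero>\<^bsub>N\<^esub>),
      add = (\<lambda>f g. \<lambda>x\<in>carrier M. f x \<oplus>\<^bsub>N\<^esub> g x) \<rparr>"


section \<open>Exact sequences\<close>

text \<open>
  Exactness involves only the additive structure, so one definition serves semimodules and
  commutative monoids alike; \<^const>\<open>a_kernel\<close> is the set of elements of the domain mapped to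
  zero.
\<close>

definition k_normal :: "('l, 'a) ring_scheme \<Rightarrow> ('m, 'b) ring_scheme \<Rightarrow> ('l \<Rightarrow> 'm) \<Rightarrow> bool"
  where "k_normal L M f \<longleftrightarrow>
    (\<forall>l\<in>carrier L. \<forall>l'\<in>carrier L. f l = f l' \<longrightarrow>
      (\<exists>k\<in>a_kernel L M f. \<exists>k'\<in>a_kernel L M f. l \<oplus>\<^bsub>L\<^esub> k = l' \<oplus>\<^bsub>L\<^esub> k'))"

definition exact_at ::
    "('l, 'a) ring_scheme \<Rightarrow> ('l \<Rightarrow> 'm) \<Rightarrow> ('m, 'b) ring_scheme \<Rightarrow> ('m \<Rightarrow> 'n) \<Rightarrow> ('n, 'c) ring_scheme \<Rightarrow> bool"
  where "exact_at L f M g N \<longleftrightarrow> f ` carrier L = a_kernel M N g \<and> k_normal M N g"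

definition zero_obj :: "unit ring"
  where "zero_obj =
    \<lparr> carrier = {()}, mult = undefined, one = undefined, zero = (), add = (\<lambda>_ _. ()) \<rparr>"

definition short_exact ::
    "('l, 'a) ring_scheme \<Rightarrow> ('l \<Rightarrow> 'm) \<Rightarrow> ('m, 'b) ring_scheme \<Rightarrow> ('m \<Rightarrow> 'n) \<Rightarrow> ('n, 'c) ring_scheme \<Rightarrow> bool"
  where "short_exact L f M g N \<longleftrightarrow>
    exact_at zero_obj (\<lambda>_. \<zero>\<^bsub>L\<^esub>) L f M \<and>
    exact_at L f M g N \<and>
    exact_at M g N (\<lambda>_. ()) zero_obj"


section \<open>e-injectivity\<close>

text \<open>
  The map induced by \<open>g\<close> on Hom monoids is \<open>h \<mapsto> compose (carrier M) h g\<close>.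

  HOL cannot quantify over types inside a definition, so \<open>L\<close> and \<open>N\<close> range over the semimodules
  whose carriers are subsets of the type \<open>'m\<close> underlying \<open>M\<close>.  Nothing is lost: in a
  short exact sequence \<open>L\<close> embeds into \<open>M\<close> and \<open>N\<close> is an image of \<open>M\<close>, so both are isomorphic
  to semimodules on subsets of \<open>'m\<close>.  The theorem \<open>e_injectiveD\<close> below proves the defining
  property for \<open>L\<close> and \<open>N\<close> over arbitrary types.
\<close>

definition e_injective ::
    "('s, 'a) ring_scheme \<Rightarrow> ('s, 'm, 'b) module_scheme \<Rightarrow> ('s, 'j, 'c) module_scheme \<Rightarrow> bool"
  where "e_injective S M J \<longleftrightarrow>
    (\<forall>(L :: ('s, 'm) module) (N :: ('s, 'm) module) f g.
      semimodule S L \<longrightarrow> semimodule S N \<longrightarrow>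
      f \<in> linear_maps S L M \<longrightarrow> g \<in> linear_maps S M N \<longrightarrow> short_exact L f M g N \<longrightarrow>
      short_exact
        (Hom_monoid S N J) (\<lambda>h. compose (carrier M) h g)
        (Hom_monoid S M J) (\<lambda>h. compose (carrier L) h f)
        (Hom_monoid S L J))"


section \<open>Basic facts\<close>

lemma linear_mapsI:
  assumes "\<And>x. x \<in> carrier M \<Longrightarrow> f x \<in> carrier N"
    and "\<And>x y. x \<in> carrier M \<Longrightarrow> y \<in> carrier M \<Longrightarrow> f (x \<oplus>\<^bsub>M\<^esub> y) = f x \<oplus>\<^bsub>N\<^esub> f y"
    and "\<And>s x. s \<in> carrier S \<Longrightarrow> x \<in> carrier M \<Longrightarrow> f (s \<odot>\<^bsub>M\<^esub> x) = s \<odot>\<^bsub>N\<^esub> f x"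
  shows "f \<in> linear_maps S M N"
  using assms by (auto simp: linear_maps_def)

lemma linear_mapsD:
  assumes "f \<in> linear_maps S M N"
  shows "x \<in> carrier M \<Longrightarrow> f x \<in> carrier N"
    and "x \<in> carrier M \<Longrightarrow> y \<in> carrier M \<Longrightarrow> f (x \<oplus>\<^bsub>M\<^esub> y) = f x \<oplus>\<^bsub>N\<^esub> f y"
    and "s \<in> carrier S \<Longrightarrow> x \<in> carrier M \<Longrightarrow> f (s \<odot>\<^bsub>M\<^esub> x) = s \<odot>\<^bsub>N\<^esub> f x"
  using assms by (auto simp: linear_maps_def)

lemma linear_maps_zero:
  assumes "semimodule S M" "semimodule S N" "f \<in> linear_maps S M N"
  shows "f \<zero>\<^bsub>M\<^esub> = \<zero>\<^bsub>N\<^esub>"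
proof -
  interpret M: semimodule S M by fact
  interpret N: semimodule S N by fact
  have "f (\<zero>\<^bsub>S\<^esub> \<odot>\<^bsub>M\<^esub> \<zero>\<^bsub>M\<^esub>) = \<zero>\<^bsub>S\<^esub> \<odot>\<^bsub>N\<^esub> f \<zero>\<^bsub>M\<^esub>"
    using assms(3) by (simp add: linear_mapsD)
  then show ?thesis
    using assms(3) by (simp add: M.smult_zero N.zero_smult linear_mapsD)
qed

lemma abelian_monoidI':
  assumes "\<And>x y. x \<in> carrier G \<Longrightarrow> y \<in> carrier G \<Longrightarrow> x \<oplus>\<^bsub>G\<^esub> y \<in> carrier G"
    and "\<zero>\<^bsub>G\<^esub> \<in> carrier G"
    and "\<And>x y z. x \<in> carrier G \<Longrightarrow> y \<in> carrier G \<Longrightarrow> z \<in> carrier G \<Longrightarrow>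
           (x \<oplus>\<^bsub>G\<^esub> y) \<oplus>\<^bsub>G\<^esub> z = x \<oplus>\<^bsub>G\<^esub> (y \<oplus>\<^bsub>G\<^esub> z)"
    and "\<And>x. x \<in> carrier G \<Longrightarrow> \<zero>\<^bsub>G\<^esub> \<oplus>\<^bsub>G\<^esub> x = x"
    and "\<And>x y. x \<in> carrier G \<Longrightarrow> y \<in> carrier G \<Longrightarrow> x \<oplus>\<^bsub>G\<^esub> y = y \<oplus>\<^bsub>G\<^esub> x"
  shows "abelian_monoid G"
  using assms by (intro abelian_monoidI) auto

lemma semimodule_prod:
  assumes "semiring S" "\<And>i. i \<in> \<Lambda> \<Longrightarrow> semimodule S (J i)"
  shows "semimodule S (prod_semimodule \<Lambda> J)"
proof -
  have ab: "abelian_monoid (J i)" if "i \<in> \<Lambda>" for i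
    using assms(2)[OF that] by (simp add: semimodule_def)
  have "abelian_monoid (prod_semimodule \<Lambda> J)"
    by (rule abelian_monoidI')
      (auto simp: prod_semimodule_def PiE_iff restrict_def fun_eq_iff extensional_def
        abelian_monoid.a_closed[OF ab] abelian_monoid.zero_closed[OF ab]
        abelian_monoid.a_assoc[OF ab] abelian_monoid.l_zero[OF ab]
        intro: abelian_monoid.a_comm[OF ab])
  then show ?thesis
    using assms(1)
    by (intro semimodule.intro semimodule_axioms.intro)
      (auto simp: prod_semimodule_def PiE_iff restrict_def fun_eq_iff extensional_def
        semimodule.smult_closed[OF assms(2)] semimodule.smult_l_distr[OF assms(2)]
        semimodule.smult_r_distr[OF assms(2)] semimodule.smult_assoc[OF assms(2)]
        semimodule.smult_one[OF assms(2)] semimodule.zero_smult[OF assms(2)]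
        semimodule.smult_zero[OF assms(2)])
qed

lemma abelian_monoid_Hom:
  assumes "semimodule S M" "semimodule S N"
  shows "abelian_monoid (Hom_monoid S M N)"
proof -
  interpret M: semimodule S M by fact
  interpret N: semimodule S N by fact
  show ?thesis
    by (rule abelian_monoidI')
      (auto simp: Hom_monoid_def linear_maps_def Pi_iff restrict_def fun_eq_iff extensional_def
        M.smult_closed N.smult_r_distr N.smult_zero N.M.a_ac)
qed

text \<open>Precomposition with a linear map is a homomorphism of Hom monoids.\<close>

lemma Hom_induced:
  assumes "semimodule S L" "semimodule S M" "semimodule S J" "f \<in> linear_maps S L M"
  defines "F \<equiv> \<lambda>h. compose (carrier L) h f"
  shows "F \<in> carrier (Hom_monoid S M J) \<rightarrow> carrier (Hom_monoid S L J)"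
    and "h \<in> carrier (Hom_monoid S M J) \<Longrightarrow> h' \<in> carrier (Hom_monoid S M J) \<Longrightarrow>
           F (h \<oplus>\<^bsub>Hom_monoid S M J\<^esub> h') = F h \<oplus>\<^bsub>Hom_monoid S L J\<^esub> F h'"
    and "F \<zero>\<^bsub>Hom_monoid S M J\<^esub> = \<zero>\<^bsub>Hom_monoid S L J\<^esub>"
proof -
  interpret L: semimodule S L by fact
  interpret M: semimodule S M by fact
  interpret J: semimodule S J by fact
  show "F \<in> carrier (Hom_monoid S M J) \<rightarrow> carrier (Hom_monoid S L J)"
    using assms(4)
    by (auto simp: F_def Hom_monoid_def linear_maps_def compose_def Pi_iff L.smult_closed)
  show "F (h \<oplus>\<^bsub>Hom_monoid S M J\<^esub> h') = F h \<oplus>\<^bsub>Hom_monoid S L J\<^esub> F h'"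
    using assms(4)
    by (auto simp: F_def Hom_monoid_def compose_def restrict_def linear_mapsD fun_eq_iff)
  show "F \<zero>\<^bsub>Hom_monoid S M J\<^esub> = \<zero>\<^bsub>Hom_monoid S L J\<^esub>"
    using assms(4)
    by (auto simp: F_def Hom_monoid_def compose_def restrict_def linear_mapsD fun_eq_iff)
qed

lemma short_exact_iff:
  assumes "abelian_monoid L" "abelian_monoid N"
    and f0: "f \<zero>\<^bsub>L\<^esub> = \<zero>\<^bsub>M\<^esub>" and g: "g \<in> carrier M \<rightarrow> carrier N"
  shows "short_exact L f M g N \<longleftrightarrow>
    inj_on f (carrier L) \<and> f ` carrier L = a_kernel M N g \<and> k_normal M N g \<and>
    g ` carrier M = carrier N"
proof -
  interpret L: abelian_monoid L by fact
  interpret N: abelian_monoid N by fact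
  have 1: "exact_at zero_obj (\<lambda>_. \<zero>\<^bsub>L\<^esub>) L f M \<longleftrightarrow> inj_on f (carrier L)" (is "?E \<longleftrightarrow> ?I")
  proof
    assume ?E
    then have "a_kernel L M f = {\<zero>\<^bsub>L\<^esub>}" "k_normal L M f"
      by (auto simp: exact_at_def zero_obj_def)
    then show ?I
      by (auto simp: k_normal_def intro!: inj_onI)
  next
    assume I: ?I
    have "x = \<zero>\<^bsub>L\<^esub>" if "x \<in> carrier L" "f x = \<zero>\<^bsub>M\<^esub>" for x
      using inj_onD[OF I _ that(1) L.zero_closed] that(2) f0 by simp
    then have ker: "a_kernel L M f = {\<zero>\<^bsub>L\<^esub>}"
      using f0 by (auto simp: a_kernel_def')
    have "k_normal L M f"
      using inj_onD[OF I] unfolding k_normal_def ker by blast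
    with ker show ?E
      by (simp add: exact_at_def zero_obj_def)
  qed
  have 2: "exact_at M g N (\<lambda>_. ()) zero_obj \<longleftrightarrow> g ` carrier M = carrier N"
  proof -
    have "a_kernel N zero_obj (\<lambda>_. ()) = carrier N"
      by (auto simp: a_kernel_def' zero_obj_def)
    moreover from this have "k_normal N zero_obj (\<lambda>_. ())"
      unfolding k_normal_def by (metis N.a_comm)
    ultimately show ?thesis
      by (simp add: exact_at_def)
  qed
  show ?thesis
    unfolding short_exact_def 1 2 unfolding exact_at_def by blast
qed

text \<open>
  The sequences considered in \<^const>\<open>e_injective\<close> may be taken over arbitrary types.
\<close>

theorem e_injectiveD:
  fixes S :: "('s, 'a) ring_scheme" and M :: "('s, 'm, 'b) module_scheme"
    and J :: "('s, 'j, 'c) module_scheme"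
    and L :: "('s, 'l, 'd) module_scheme" and N :: "('s, 'n, 'e) module_scheme"
  assumes inj: "e_injective S M J"
    and SM: "semimodule S M" and SJ: "semimodule S J"
    and SL: "semimodule S L" and SN: "semimodule S N"
    and f: "f \<in> linear_maps S L M" and g: "g \<in> linear_maps S M N"
    and ex: "short_exact L f M g N"
  shows "short_exact
    (Hom_monoid S N J) (\<lambda>h. compose (carrier M) h g)
    (Hom_monoid S M J) (\<lambda>h. compose (carrier L) h f)
    (Hom_monoid S L J)"
proof -
  interpret M: semimodule S M by fact
  interpret J: semimodule S J by fact
  interpret L: semimodule S L by fact
  interpret N: semimodule S N by fact
  have SR: "semiring S" using SM by (simp add: semimodule_def)
  note f' [simp] = linear_mapsD[OF f]
  note g' [simp] = linear_mapsD[OF g]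
  note sc [simp] = M.smult_closed L.smult_closed N.smult_closed
  have f0 [simp]: "f \<zero>\<^bsub>L\<^esub> = \<zero>\<^bsub>M\<^esub>" by (rule linear_maps_zero[OF SL SM f])
  have g0 [simp]: "g \<zero>\<^bsub>M\<^esub> = \<zero>\<^bsub>N\<^esub>" by (rule linear_maps_zero[OF SM SN g])
  have "inj_on f (carrier L) \<and> f ` carrier L = a_kernel M N g \<and> k_normal M N g \<and>
      g ` carrier M = carrier N"
    using ex by (subst (asm) short_exact_iff) (auto intro: L.abelian_monoid_axioms N.abelian_monoid_axioms)
  then have injf: "inj_on f (carrier L)" and imf: "f ` carrier L = a_kernel M N g"
    and kng: "k_normal M N g" and surg: "g ` carrier M = carrier N" by auto
  define L' :: "('s, 'm) module" where "L' =
    \<lparr> carrier = f ` carrier L, mult = undefined, one = undefined,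
      zero = \<zero>\<^bsub>M\<^esub>, add = add M, smult = smult M \<rparr>"
  define t where "t = inv_into (carrier M) g"
  have gt [simp]: "g (t n) = n" if "n \<in> carrier N" for n
    using that surg by (simp add: t_def f_inv_into_f)
  have tM [simp]: "t n \<in> carrier M" if "n \<in> carrier N" for n
    using that surg by (simp add: t_def inv_into_into)
  have t_inj: "t x = t y \<longleftrightarrow> x = y" if "x \<in> carrier N" "y \<in> carrier N" for x y
    using that gt by metis
  define N' :: "('s, 'm) module" where "N' =
    \<lparr> carrier = t ` carrier N, mult = undefined, one = undefined,
      zero = t \<zero>\<^bsub>N\<^esub>, add = (\<lambda>x y. t (g x \<oplus>\<^bsub>N\<^esub> g y)), smult = (\<lambda>s x. t (s \<odot>\<^bsub>N\<^esub> g x)) \<rparr>"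
  have fadd: "f x \<oplus>\<^bsub>M\<^esub> f y = f (x \<oplus>\<^bsub>L\<^esub> y)" if "x \<in> carrier L" "y \<in> carrier L" for x y
    using that by simp
  have fsm: "s \<odot>\<^bsub>M\<^esub> f x = f (s \<odot>\<^bsub>L\<^esub> x)" if "s \<in> carrier S" "x \<in> carrier L" for s x
    using that by simp
  have abL': "abelian_monoid L'"
    by (rule abelian_monoidI')
      (auto simp: L'_def fadd f0[symmetric] L.M.a_ac simp del: f0 f'(2))
  have SL': "semimodule S L'"
    using abL' SR
    by (intro semimodule.intro semimodule_axioms.intro)
      (auto simp: L'_def fadd fsm f0[symmetric] L.smult_l_distr L.smult_r_distr L.smult_assoc
        L.smult_one L.zero_smult L.smult_zero simp del: f0 f'(2,3))
  have abN': "abelian_monoid N'"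
    by (rule abelian_monoidI') (auto simp: N'_def N.M.a_ac)
  have SN': "semimodule S N'"
    using abN' SR
    by (intro semimodule.intro semimodule_axioms.intro)
      (auto simp: N'_def N.smult_l_distr N.smult_r_distr N.smult_assoc
        N.smult_one N.zero_smult N.smult_zero)
  define g2 where "g2 = (\<lambda>x. t (g x))"
  have idl: "(\<lambda>x. x) \<in> linear_maps S L' M"
    by (rule linear_mapsI) (auto simp: L'_def)
  have g2l: "g2 \<in> linear_maps S M N'"
    by (rule linear_mapsI) (auto simp: N'_def g2_def)
  have kerg2: "a_kernel M N' g2 = a_kernel M N g"
    by (auto simp: a_kernel_def' N'_def g2_def t_inj)
  have "short_exact L' (\<lambda>x. x) M g2 N'"
  proof (subst short_exact_iff[OF abL' abN'])
    show "\<zero>\<^bsub>L'\<^esub> = \<zero>\<^bsub>M\<^esub>" by (simp add: L'_def)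
    show "g2 \<in> carrier M \<rightarrow> carrier N'" using g2l by (auto simp: linear_maps_def)
    have "g2 ` carrier M = carrier N'"
      unfolding g2_def N'_def by (simp flip: surg add: image_image)
    moreover have "k_normal M N' g2"
      using kng unfolding k_normal_def kerg2 by (auto simp: g2_def t_inj)
    ultimately show "inj_on (\<lambda>x. x) (carrier L') \<and> (\<lambda>x. x) ` carrier L' = a_kernel M N' g2 \<and>
        k_normal M N' g2 \<and> g2 ` carrier M = carrier N'"
      by (auto simp: kerg2 L'_def imf)
  qed
  then have *: "short_exact
      (Hom_monoid S N' J) (\<lambda>h. compose (carrier M) h g2)
      (Hom_monoid S M J) (\<lambda>h. compose (carrier L') h (\<lambda>x. x))
      (Hom_monoid S L' J)"
    using inj SL' SN' idl g2l unfolding e_injective_def by blast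
  have **: "(\<lambda>h. compose (carrier M) h g2) ` carrier (Hom_monoid S N' J)
        = a_kernel (Hom_monoid S M J) (Hom_monoid S L' J) (\<lambda>h. compose (carrier L') h (\<lambda>x. x)) \<and>
      k_normal (Hom_monoid S M J) (Hom_monoid S L' J) (\<lambda>h. compose (carrier L') h (\<lambda>x. x)) \<and>
      (\<lambda>h. compose (carrier L') h (\<lambda>x. x)) ` carrier (Hom_monoid S M J) = carrier (Hom_monoid S L' J)"
    using * Hom_induced[OF SL' SM SJ idl] Hom_induced[OF SM SN' SJ g2l]
    by (subst (asm) short_exact_iff) (auto intro: abelian_monoid_Hom SL' SN' SJ)
  have compose_eq: "compose A h u = (\<lambda>x\<in>A. v x) \<longleftrightarrow> (\<forall>x\<in>A. h (u x) = v x)"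
    for A :: "'x set" and h :: "'m \<Rightarrow> 'j" and u v
    by (auto simp: compose_def restrict_def fun_eq_iff)
  have eqv: "compose (carrier L') h (\<lambda>x. x) = compose (carrier L') h' (\<lambda>x. x) \<longleftrightarrow>
      compose (carrier L) h f = compose (carrier L) h' f" for h h' :: "'m \<Rightarrow> 'j"
    unfolding compose_def[of _ h'] compose_eq by (simp add: L'_def)
  have ker: "a_kernel (Hom_monoid S M J) (Hom_monoid S L' J) (\<lambda>h. compose (carrier L') h (\<lambda>x. x)) =
      a_kernel (Hom_monoid S M J) (Hom_monoid S L J) (\<lambda>h. compose (carrier L) h f)"
    unfolding a_kernel_def' by (simp add: Hom_monoid_def compose_eq L'_def)
  have 1: "inj_on (\<lambda>h. compose (carrier M) h g) (carrier (Hom_monoid S N J))"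
  proof (rule inj_onI)
    fix h h' assume h: "h \<in> carrier (Hom_monoid S N J)" "h' \<in> carrier (Hom_monoid S N J)"
      and eq: "compose (carrier M) h g = compose (carrier M) h' g"
    show "h = h'"
    proof (rule extensionalityI[of _ "carrier N"])
      fix n assume n: "n \<in> carrier N"
      show "h n = h' n"
        using fun_cong[OF eq, of "t n"] n by (simp add: compose_def)
    qed (use h in \<open>auto simp: Hom_monoid_def\<close>)
  qed
  have img: "(\<lambda>h. compose (carrier M) h g) ` carrier (Hom_monoid S N J) =
      (\<lambda>h. compose (carrier M) h g2) ` carrier (Hom_monoid S N' J)" (is "?A = ?B")
  proof (intro equalityI subsetI)
    fix u assume "u \<in> ?A"
    then obtain h where h: "h \<in> carrier (Hom_monoid S N J)" "u = compose (carrier M) h g" by auto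
    let ?h = "restrict (\<lambda>x. h (g x)) (carrier N')"
    have "u = compose (carrier M) ?h g2"
      by (auto simp: h(2) compose_def restrict_def N'_def g2_def fun_eq_iff)
    moreover have "?h \<in> carrier (Hom_monoid S N' J)"
      using h(1) by (auto simp: Hom_monoid_def linear_maps_def N'_def)
    ultimately show "u \<in> ?B" by blast
  next
    fix u assume "u \<in> ?B"
    then obtain h where h: "h \<in> carrier (Hom_monoid S N' J)" "u = compose (carrier M) h g2" by auto
    let ?h = "restrict (\<lambda>x. h (t x)) (carrier N)"
    have "u = compose (carrier M) ?h g"
      by (auto simp: h(2) compose_def restrict_def N'_def g2_def fun_eq_iff)
    moreover have "?h \<in> carrier (Hom_monoid S N J)"
      using h(1) by (auto simp: Hom_monoid_def linear_maps_def N'_def)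
    ultimately show "u \<in> ?A" by blast
  qed
  have kn: "k_normal (Hom_monoid S M J) (Hom_monoid S L J) (\<lambda>h. compose (carrier L) h f)"
    using ** unfolding k_normal_def ker eqv by blast
  have sur: "(\<lambda>h. compose (carrier L) h f) ` carrier (Hom_monoid S M J) = carrier (Hom_monoid S L J)"
  proof (intro equalityI subsetI)
    fix u assume u: "u \<in> carrier (Hom_monoid S L J)"
    let ?r = "inv_into (carrier L) f"
    have r [simp]: "?r (f x) = x" if "x \<in> carrier L" for x
      using injf that by simp
    let ?u = "restrict (\<lambda>x. u (?r x)) (carrier L')"
    have "?u \<in> carrier (Hom_monoid S L' J)"
      using u by (auto simp: Hom_monoid_def linear_maps_def L'_def fadd fsm simp del: f'(2,3))
    then have "?u \<in> (\<lambda>h. compose (carrier L') h (\<lambda>x. x)) ` carrier (Hom_monoid S M J)"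
      using ** by simp
    then obtain h where h: "h \<in> carrier (Hom_monoid S M J)" "?u = compose (carrier L') h (\<lambda>x. x)"
      by blast
    have "u = compose (carrier L) h f"
    proof (rule extensionalityI[of _ "carrier L"])
      fix x assume x: "x \<in> carrier L"
      show "u x = compose (carrier L) h f x"
        using fun_cong[OF h(2), of "f x"] x by (simp add: compose_def L'_def)
    qed (use u in \<open>auto simp: Hom_monoid_def compose_def\<close>)
    with h(1) show "u \<in> (\<lambda>h. compose (carrier L) h f) ` carrier (Hom_monoid S M J)" by blast
  qed (use Hom_induced(1)[OF SL SM SJ f] in auto)
  show ?thesis
    using 1 img ** ker kn sur
      Hom_induced[OF SL SM SJ f] Hom_induced[OF SM SN SJ g]
    by (subst short_exact_iff) (auto intro: abelian_monoid_Hom SL SN SJ)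
qed

end

theory Submission
  imports Defs
begin

text \<open>
  For a short exact sequence \<open>0 \<rightarrow> L \<rightarrow> M \<rightarrow> N \<rightarrow> 0\<close>, exactness of the Hom sequence into \<open>J\<close> amounts
  to three conditions on linear maps into \<open>J\<close>: maps on \<open>M\<close> vanishing on \<open>L\<close> factor through \<open>N\<close>, maps
  on \<open>M\<close> that agree on \<open>L\<close> become equal after adding maps vanishing on \<open>L\<close>, and maps on \<open>L\<close> extend
  to \<open>M\<close>.  A linear map into a product is a family of linear maps into the factors, so solutions for
  the factors assemble to one for the product.  Conversely, a problem for the factor \<open>J\<^sub>i\<close> becomes
  one for the product by filling the other coordinates with zero maps, and the \<open>i\<close>-th coordinate of
  its solution solves the original problem.
\<close>

section \<open>Linear maps and their restrictions to the carrier\<close>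

lemma restrict_eq_iff: "restrict u A = restrict v A \<longleftrightarrow> (\<forall>i\<in>A. u i = v i)"
  by (auto simp: restrict_def fun_eq_iff)

lemma compose_eq_iff: "compose A h u = compose A h' u \<longleftrightarrow> (\<forall>x\<in>A. h (u x) = h' (u x))"
  by (simp add: compose_def restrict_eq_iff)

text \<open>Linearity only involves values on the carrier, which is closed under the operations
  because \<open>M\<close> is a semimodule. This permits passing from a linear map to its
  extensional representative in the Hom monoid.\<close>

lemma linear_maps_cong:
  assumes "semimodule S M" "f \<in> linear_maps S M N" "\<And>x. x \<in> carrier M \<Longrightarrow> f' x = f x"
  shows "f' \<in> linear_maps S M N"
proof -
  interpret M: semimodule S M by fact
  show ?thesis
    using linear_mapsD[OF assms(2)] assms(3) by (intro linear_mapsI) (auto simp: M.smult_closed)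
qed

lemma linear_maps_const_zero:
  assumes "semimodule S N"
  shows "(\<lambda>_. \<zero>\<^bsub>N\<^esub>) \<in> linear_maps S M N"
proof -
  interpret N: semimodule S N by fact
  show ?thesis by (rule linear_mapsI) (auto simp: N.smult_zero)
qed

lemma restrict_in_Hom:
  assumes "semimodule S M" "f \<in> linear_maps S M N"
  shows "restrict f (carrier M) \<in> carrier (Hom_monoid S M N)"
  using linear_maps_cong[OF assms, of "restrict f (carrier M)"] by (simp add: Hom_monoid_def)

section \<open>Exactness of the Hom sequence in terms of linear maps\<close>

definition hom_exact ::
    "('s, 'a) ring_scheme \<Rightarrow> ('s, 'l, 'b) module_scheme \<Rightarrow> ('l \<Rightarrow> 'm) \<Rightarrow> ('s, 'm, 'c) module_scheme \<Rightarrow>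
      ('m \<Rightarrow> 'n) \<Rightarrow> ('s, 'n, 'd) module_scheme \<Rightarrow> ('s, 'j, 'e) module_scheme \<Rightarrow> bool"
  where "hom_exact S L f M g N J \<longleftrightarrow>
    (\<forall>h\<in>linear_maps S M J. (\<forall>x\<in>carrier L. h (f x) = \<zero>\<^bsub>J\<^esub>) \<longrightarrow>
      (\<exists>u\<in>linear_maps S N J. \<forall>x\<in>carrier M. h x = u (g x))) \<and>
    (\<forall>h\<in>linear_maps S M J. \<forall>h'\<in>linear_maps S M J. (\<forall>x\<in>carrier L. h (f x) = h' (f x)) \<longrightarrow>
      (\<exists>k\<in>linear_maps S M J. \<exists>k'\<in>linear_maps S M J.
        (\<forall>x\<in>carrier L. k (f x) = \<zero>\<^bsub>J\<^esub> \<and> k' (f x) = \<zero>\<^bsub>J\<^esub>) \<and>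
        (\<forall>x\<in>carrier M. h x \<oplus>\<^bsub>J\<^esub> k x = h' x \<oplus>\<^bsub>J\<^esub> k' x))) \<and>
    (\<forall>u\<in>linear_maps S L J. \<exists>h\<in>linear_maps S M J. \<forall>x\<in>carrier L. h (f x) = u x)"

lemma hom_exact_factor:
  assumes "hom_exact S L f M g N J" "h \<in> linear_maps S M J" "\<forall>x\<in>carrier L. h (f x) = \<zero>\<^bsub>J\<^esub>"
  shows "\<exists>u\<in>linear_maps S N J. \<forall>x\<in>carrier M. h x = u (g x)"
  by (rule mp[OF bspec[OF conjunct1[OF assms(1)[unfolded hom_exact_def]] assms(2)] assms(3)])

lemma hom_exact_normal:
  assumes "hom_exact S L f M g N J" "h \<in> linear_maps S M J" "h' \<in> linear_maps S M J"
    and "\<forall>x\<in>carrier L. h (f x) = h' (f x)"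
  shows "\<exists>k\<in>linear_maps S M J. \<exists>k'\<in>linear_maps S M J.
    (\<forall>x\<in>carrier L. k (f x) = \<zero>\<^bsub>J\<^esub> \<and> k' (f x) = \<zero>\<^bsub>J\<^esub>) \<and>
    (\<forall>x\<in>carrier M. h x \<oplus>\<^bsub>J\<^esub> k x = h' x \<oplus>\<^bsub>J\<^esub> k' x)"
  by (rule mp[OF bspec[OF bspec[OF conjunct1[OF conjunct2[OF assms(1)[unfolded hom_exact_def]]]
    assms(2)] assms(3)] assms(4)])

lemma hom_exact_extend:
  assumes "hom_exact S L f M g N J" "u \<in> linear_maps S L J"
  shows "\<exists>h\<in>linear_maps S M J. \<forall>x\<in>carrier L. h (f x) = u x"
  by (rule bspec[OF conjunct2[OF conjunct2[OF assms(1)[unfolded hom_exact_def]]] assms(2)])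

text \<open>By \<open>short_exact_iff\<close>, exactness splits into injectivity of
  \<open>?G\<close>, image equal to kernel, \<open>k\<close>-normality and surjectivity of
  \<open>?F\<close>. The first follows from surjectivity of \<open>g\<close>; \<open>A\<close>,
  \<open>B\<close> and \<open>C\<close> match the other three with the clauses of
  \<open>hom_exact\<close>.\<close>

lemma short_exact_Hom_iff:
  assumes SL: "semimodule S L" and SM: "semimodule S M" and SN: "semimodule S N"
    and SJ: "semimodule S J"
    and f: "f \<in> linear_maps S L M" and g: "g \<in> linear_maps S M N"
    and ex: "short_exact L f M g N"
  shows "short_exact
      (Hom_monoid S N J) (\<lambda>h. compose (carrier M) h g)
      (Hom_monoid S M J) (\<lambda>h. compose (carrier L) h f)
      (Hom_monoid S L J) \<longleftrightarrow> hom_exact S L f M g N J"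
proof -
  interpret M: semimodule S M by fact
  interpret J: semimodule S J by fact
  interpret L: semimodule S L by fact
  interpret N: semimodule S N by fact
  let ?G = "\<lambda>h. compose (carrier M) h g" and ?F = "\<lambda>h. compose (carrier L) h f"
  let ?HN = "Hom_monoid S N J" and ?HM = "Hom_monoid S M J" and ?HL = "Hom_monoid S L J"
  note f' [simp] = linear_mapsD(1)[OF f]
  note g' [simp] = linear_mapsD(1)[OF g]
  have "f ` carrier L = a_kernel M N g \<and> g ` carrier M = carrier N"
    using ex linear_maps_zero[OF SL SM f] g'
    by (subst (asm) short_exact_iff) (auto intro: L.abelian_monoid_axioms N.abelian_monoid_axioms)
  then have imf: "f ` carrier L = a_kernel M N g" and surg: "g ` carrier M = carrier N" by auto
  have gf: "g (f x) = \<zero>\<^bsub>N\<^esub>" if "x \<in> carrier L" for x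
    using imf that by (auto simp: a_kernel_def')
  have lin: "h \<in> linear_maps S M J" if "h \<in> carrier ?HM" for h
    using that by (simp add: Hom_monoid_def)
  have resM: "restrict h (carrier M) \<in> carrier ?HM" if "h \<in> linear_maps S M J" for h
    by (rule restrict_in_Hom[OF SM that])
  have ker: "h \<in> a_kernel ?HM ?HL ?F \<longleftrightarrow> h \<in> carrier ?HM \<and> (\<forall>x\<in>carrier L. h (f x) = \<zero>\<^bsub>J\<^esub>)" for h
    by (auto simp: a_kernel_def' Hom_monoid_def compose_def restrict_def fun_eq_iff)
  \<comment> \<open>Since \<open>g\<close> is onto, maps whose composites with \<open>g\<close>
    coincide agree on all of \<open>carrier N\<close>.\<close>
  have inj: "inj_on ?G (carrier ?HN)"
  proof (rule inj_onI)
    fix h h' assume h: "h \<in> carrier ?HN" "h' \<in> carrier ?HN" and eq: "?G h = ?G h'"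
    have "\<forall>x\<in>carrier M. h (g x) = h' (g x)"
      using compose_eq_iff[THEN iffD1, OF eq] .
    then have "\<forall>n\<in>carrier N. h n = h' n"
      by (simp flip: surg)
    with h show "h = h'"
      by (auto simp: Hom_monoid_def intro: extensionalityI)
  qed
  have A: "?G ` carrier ?HN = a_kernel ?HM ?HL ?F \<longleftrightarrow>
      (\<forall>h\<in>linear_maps S M J. (\<forall>x\<in>carrier L. h (f x) = \<zero>\<^bsub>J\<^esub>) \<longrightarrow>
        (\<exists>u\<in>linear_maps S N J. \<forall>x\<in>carrier M. h x = u (g x)))" (is "?E \<longleftrightarrow> ?R")
  proof
    assume E: ?E
    show ?R
    proof (intro ballI impI)
      fix h assume h: "h \<in> linear_maps S M J" "\<forall>x\<in>carrier L. h (f x) = \<zero>\<^bsub>J\<^esub>"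
      then have "restrict h (carrier M) \<in> a_kernel ?HM ?HL ?F"
        unfolding ker using resM by simp
      then obtain u where u: "u \<in> carrier ?HN" "restrict h (carrier M) = ?G u"
        using E by blast
      have "\<forall>x\<in>carrier M. h x = u (g x)"
      proof
        fix x assume "x \<in> carrier M"
        then show "h x = u (g x)" using fun_cong[OF u(2), of x] by (simp add: compose_def)
      qed
      with u(1) show "\<exists>u\<in>linear_maps S N J. \<forall>x\<in>carrier M. h x = u (g x)"
        by (auto simp: Hom_monoid_def)
    qed
  next
    assume R: ?R
    show ?E
    proof (intro equalityI subsetI)
      fix h assume "h \<in> ?G ` carrier ?HN"
      then obtain u where u: "u \<in> carrier ?HN" "h = ?G u" by blast
      \<comment> \<open>The image of \<open>?G\<close> lies in the kernel of \<open>?F\<close>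
        because \<open>g\<close> kills every \<open>f x\<close> and \<open>u\<close> preserves zero;
        only the opposite inclusion depends on \<open>?R\<close>.\<close>
      then have "u \<zero>\<^bsub>N\<^esub> = \<zero>\<^bsub>J\<^esub>"
        using linear_maps_zero[OF SN SJ] by (simp add: Hom_monoid_def)
      with u Hom_induced(1)[OF SM SN SJ g] show "h \<in> a_kernel ?HM ?HL ?F"
        unfolding ker by (auto simp: compose_def gf)
    next
      fix h assume "h \<in> a_kernel ?HM ?HL ?F"
      then have h: "h \<in> carrier ?HM" "\<forall>x\<in>carrier L. h (f x) = \<zero>\<^bsub>J\<^esub>" by (auto simp: ker)
      then obtain u where u: "u \<in> linear_maps S N J" "\<forall>x\<in>carrier M. h x = u (g x)"
        using R lin by blast
      \<comment> \<open>The restriction is a genuine element of \<open>?HN\<close>, and composition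
        with \<open>g\<close> does not see the difference, as \<open>g\<close> takes values in
        \<open>carrier N\<close>.\<close>
      have "h = ?G (restrict u (carrier N))"
      proof (rule extensionalityI[of _ "carrier M"])
        show "h \<in> extensional (carrier M)" using h by (simp add: Hom_monoid_def)
      qed (use u in \<open>auto simp: compose_def\<close>)
      with restrict_in_Hom[OF SN u(1)] show "h \<in> ?G ` carrier ?HN" by blast
    qed
  qed
  have B: "k_normal ?HM ?HL ?F \<longleftrightarrow>
      (\<forall>h\<in>linear_maps S M J. \<forall>h'\<in>linear_maps S M J. (\<forall>x\<in>carrier L. h (f x) = h' (f x)) \<longrightarrow>
        (\<exists>k\<in>linear_maps S M J. \<exists>k'\<in>linear_maps S M J.
          (\<forall>x\<in>carrier L. k (f x) = \<zero>\<^bsub>J\<^esub> \<and> k' (f x) = \<zero>\<^bsub>J\<^esub>) \<and>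
          (\<forall>x\<in>carrier M. h x \<oplus>\<^bsub>J\<^esub> k x = h' x \<oplus>\<^bsub>J\<^esub> k' x)))" (is "?E \<longleftrightarrow> ?R")
  proof -
    have add_eq: "h \<oplus>\<^bsub>?HM\<^esub> k = h' \<oplus>\<^bsub>?HM\<^esub> k' \<longleftrightarrow>
        (\<forall>x\<in>carrier M. h x \<oplus>\<^bsub>J\<^esub> k x = h' x \<oplus>\<^bsub>J\<^esub> k' x)" for h k h' k'
      by (auto simp: Hom_monoid_def restrict_def fun_eq_iff)
    show ?thesis
    proof
      assume E: ?E
      show ?R
      proof (intro ballI impI)
        fix h h' assume h: "h \<in> linear_maps S M J" "h' \<in> linear_maps S M J"
          and eq: "\<forall>x\<in>carrier L. h (f x) = h' (f x)"
        \<comment> \<open>Restricting moves \<open>h\<close> and \<open>h'\<close> into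
          \<open>?HM\<close> and leaves their composites with \<open>f\<close> unchanged, because
          \<open>f\<close> takes values in \<open>carrier M\<close>.\<close>
        have "?F (restrict h (carrier M)) = ?F (restrict h' (carrier M))"
          unfolding compose_eq_iff using eq by simp
        then obtain k k' where k: "k \<in> a_kernel ?HM ?HL ?F" "k' \<in> a_kernel ?HM ?HL ?F"
          "restrict h (carrier M) \<oplus>\<^bsub>?HM\<^esub> k = restrict h' (carrier M) \<oplus>\<^bsub>?HM\<^esub> k'"
          using E resM[OF h(1)] resM[OF h(2)] unfolding k_normal_def by blast
        then show "\<exists>k\<in>linear_maps S M J. \<exists>k'\<in>linear_maps S M J.
            (\<forall>x\<in>carrier L. k (f x) = \<zero>\<^bsub>J\<^esub> \<and> k' (f x) = \<zero>\<^bsub>J\<^esub>) \<and>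
            (\<forall>x\<in>carrier M. h x \<oplus>\<^bsub>J\<^esub> k x = h' x \<oplus>\<^bsub>J\<^esub> k' x)"
          unfolding ker add_eq
          by (intro bexI[of _ k] bexI[of _ k']) (auto intro: lin)
      qed
    next
      assume R: ?R
      show ?E
        unfolding k_normal_def add_eq compose_eq_iff
      proof (intro ballI impI)
        fix h h' assume h: "h \<in> carrier ?HM" "h' \<in> carrier ?HM"
          and eq: "\<forall>x\<in>carrier L. h (f x) = h' (f x)"
        obtain k k' where k: "k \<in> linear_maps S M J" "k' \<in> linear_maps S M J"
          "\<forall>x\<in>carrier L. k (f x) = \<zero>\<^bsub>J\<^esub> \<and> k' (f x) = \<zero>\<^bsub>J\<^esub>"
          "\<forall>x\<in>carrier M. h x \<oplus>\<^bsub>J\<^esub> k x = h' x \<oplus>\<^bsub>J\<^esub> k' x"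
          using mp[OF bspec[OF bspec[OF R lin[OF h(1)]] lin[OF h(2)]] eq] by (elim bexE conjE)
        then show "\<exists>k\<in>a_kernel ?HM ?HL ?F. \<exists>k'\<in>a_kernel ?HM ?HL ?F.
            \<forall>x\<in>carrier M. h x \<oplus>\<^bsub>J\<^esub> k x = h' x \<oplus>\<^bsub>J\<^esub> k' x"
          by (intro bexI[of _ "restrict k (carrier M)"] bexI[of _ "restrict k' (carrier M)"])
            (auto simp: ker resM)
      qed
    qed
  qed
  have C: "?F ` carrier ?HM = carrier ?HL \<longleftrightarrow>
      (\<forall>u\<in>linear_maps S L J. \<exists>h\<in>linear_maps S M J. \<forall>x\<in>carrier L. h (f x) = u x)"
    (is "?E \<longleftrightarrow> ?R")
  proof
    assume E: ?E
    show ?R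
    proof
      fix u assume "u \<in> linear_maps S L J"
      then have "restrict u (carrier L) \<in> ?F ` carrier ?HM"
        using restrict_in_Hom[OF SL] E by simp
      then obtain h where h: "h \<in> carrier ?HM" "restrict u (carrier L) = ?F h" by blast
      have "\<forall>x\<in>carrier L. h (f x) = u x"
      proof
        fix x assume "x \<in> carrier L"
        then show "h (f x) = u x" using fun_cong[OF h(2), of x] by (simp add: compose_def)
      qed
      with h(1) lin show "\<exists>h\<in>linear_maps S M J. \<forall>x\<in>carrier L. h (f x) = u x" by blast
    qed
  next
    assume R: ?R
    have "u \<in> ?F ` carrier ?HM" if u: "u \<in> carrier ?HL" for u
    proof -
      from u R obtain h where h: "h \<in> linear_maps S M J" "\<forall>x\<in>carrier L. h (f x) = u x"
        by (auto simp: Hom_monoid_def)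
      have "u = ?F (restrict h (carrier M))"
      proof (rule extensionalityI[of _ "carrier L"])
        show "u \<in> extensional (carrier L)" using u by (simp add: Hom_monoid_def)
      qed (use h in \<open>auto simp: compose_def\<close>)
      with resM[OF h(1)] show ?thesis by blast
    qed
    with Hom_induced(1)[OF SL SM SJ f] show ?E by blast
  qed
  show ?thesis
    unfolding hom_exact_def A[symmetric] B[symmetric] C[symmetric]
    using inj Hom_induced[OF SL SM SJ f] Hom_induced[OF SM SN SJ g]
    by (subst short_exact_iff) (auto intro: abelian_monoid_Hom SL SN SJ)
qed

section \<open>Linear maps into a product\<close>

lemma prod_semimodule_simps:
  "carrier (prod_semimodule \<Lambda> J) = (\<Pi>\<^sub>E i\<in>\<Lambda>. carrier (J i))"
  "\<zero>\<^bsub>prod_semimodule \<Lambda> J\<^esub> = (\<lambda>i\<in>\<Lambda>. \<zero>\<^bsub>J i\<^esub>)"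
  "x \<oplus>\<^bsub>prod_semimodule \<Lambda> J\<^esub> y = (\<lambda>i\<in>\<Lambda>. x i \<oplus>\<^bsub>J i\<^esub> y i)"
  "s \<odot>\<^bsub>prod_semimodule \<Lambda> J\<^esub> x = (\<lambda>i\<in>\<Lambda>. s \<odot>\<^bsub>J i\<^esub> x i)"
  by (simp_all add: prod_semimodule_def)

lemma linear_maps_prod_component:
  assumes "f \<in> linear_maps S M (prod_semimodule \<Lambda> J)" "i \<in> \<Lambda>"
  shows "(\<lambda>x. f x i) \<in> linear_maps S M (J i)"
  using linear_mapsD[OF assms(1)] assms(2)
  by (intro linear_mapsI) (auto simp: prod_semimodule_simps PiE_iff)

text \<open>The product operations act coordinatewise. Together with
  \<open>linear_maps_prod_component\<close> this is the universal property of the product.\<close>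

lemma linear_maps_prod_tuple:
  assumes "\<And>i. i \<in> \<Lambda> \<Longrightarrow> f i \<in> linear_maps S M (J i)"
  shows "(\<lambda>x. \<lambda>i\<in>\<Lambda>. f i x) \<in> linear_maps S M (prod_semimodule \<Lambda> J)"
  using linear_mapsD[OF assms]
  by (intro linear_mapsI) (auto simp: prod_semimodule_simps fun_eq_iff restrict_def)

text \<open>Elements of the product are extensional on \<open>\<Lambda>\<close>, so equality of
  values can be checked at the indices in \<open>\<Lambda>\<close> alone.\<close>

lemma linear_maps_prod_ext:
  assumes "f \<in> linear_maps S M (prod_semimodule \<Lambda> J)" "x \<in> carrier M"
  shows "f x = (\<lambda>i\<in>\<Lambda>. f x i)"
  using linear_mapsD(1)[OF assms] by (simp add: prod_semimodule_simps PiE_iff extensional_restrict)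

text \<open>For \<open>i\<close> in \<open>\<Lambda>\<close> this is \<open>h\<close> followed by
  the canonical insertion of \<open>J i\<close> into the product.\<close>

lemma linear_maps_prod_extend:
  assumes "\<And>i. i \<in> \<Lambda> \<Longrightarrow> semimodule S (J i)" "h \<in> linear_maps S M (J i)"
  shows "(\<lambda>x. \<lambda>j\<in>\<Lambda>. if j = i then h x else \<zero>\<^bsub>J j\<^esub>) \<in> linear_maps S M (prod_semimodule \<Lambda> J)"
proof (rule linear_maps_prod_tuple)
  fix j assume "j \<in> \<Lambda>"
  then show "(\<lambda>x. if j = i then h x else \<zero>\<^bsub>J j\<^esub>) \<in> linear_maps S M (J j)"
    using assms linear_maps_const_zero[of S "J j" M] by (cases "j = i") simp_all
qed

text \<open>The sequence stays fixed, and each of the three clauses is transferred separately, by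
  insertion and projection in one direction and by tupling in the other.\<close>

lemma hom_exact_prod_iff:
  assumes J: "\<And>i. i \<in> \<Lambda> \<Longrightarrow> semimodule S (J i)"
  shows "hom_exact S L f M g N (prod_semimodule \<Lambda> J) \<longleftrightarrow> (\<forall>i\<in>\<Lambda>. hom_exact S L f M g N (J i))"
    (is "hom_exact _ _ _ _ _ _ ?P \<longleftrightarrow> _")
proof (intro iffI ballI)
  fix i assume P: "hom_exact S L f M g N ?P" and i: "i \<in> \<Lambda>"
  let ?e = "\<lambda>h x. \<lambda>j\<in>\<Lambda>. if j = i then h x else \<zero>\<^bsub>J j\<^esub>"
  \<comment> \<open>The domain has its own type variables because the insertion is applied both to
    maps on \<open>M\<close> and to maps on \<open>L\<close>.\<close>
  have e: "?e h \<in> linear_maps S M' ?P" if "h \<in> linear_maps S M' (J i)"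
    for h :: "'x \<Rightarrow> _" and M' :: "(_, 'x, 'y) module_scheme"
    using that by (intro linear_maps_prod_extend J)
  note c = linear_maps_prod_component[OF _ i]
  show "hom_exact S L f M g N (J i)"
    unfolding hom_exact_def
  proof (intro conjI ballI impI)
    fix h assume h: "h \<in> linear_maps S M (J i)" "\<forall>x\<in>carrier L. h (f x) = \<zero>\<^bsub>J i\<^esub>"
    then have "\<forall>x\<in>carrier L. ?e h (f x) = \<zero>\<^bsub>?P\<^esub>"
      by (auto simp: prod_semimodule_simps restrict_eq_iff)
    from hom_exact_factor[OF P e[OF h(1)] this]
    obtain u where u: "u \<in> linear_maps S N ?P" "\<forall>x\<in>carrier M. ?e h x = u (g x)"
      by (elim bexE)
    have "h x = u (g x) i" if "x \<in> carrier M" for x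
      using fun_cong[OF bspec[OF u(2) that], of i] i by simp
    with c[OF u(1)] show "\<exists>u\<in>linear_maps S N (J i). \<forall>x\<in>carrier M. h x = u (g x)"
      by (intro bexI[of _ "\<lambda>x. u x i"]) auto
  next
    fix h h' assume h: "h \<in> linear_maps S M (J i)" "h' \<in> linear_maps S M (J i)"
      and eq: "\<forall>x\<in>carrier L. h (f x) = h' (f x)"
    have "\<forall>x\<in>carrier L. ?e h (f x) = ?e h' (f x)"
      using eq by (auto simp: restrict_eq_iff)
    from hom_exact_normal[OF P e[OF h(1)] e[OF h(2)] this]
    obtain k k' where k: "k \<in> linear_maps S M ?P" "k' \<in> linear_maps S M ?P"
      and z: "\<forall>x\<in>carrier L. k (f x) = \<zero>\<^bsub>?P\<^esub> \<and> k' (f x) = \<zero>\<^bsub>?P\<^esub>"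
      and a: "\<forall>x\<in>carrier M. ?e h x \<oplus>\<^bsub>?P\<^esub> k x = ?e h' x \<oplus>\<^bsub>?P\<^esub> k' x"
      by (elim bexE conjE)
    \<comment> \<open>Coordinate \<open>i\<close> of \<open>?e h x\<close> is \<open>h x\<close>, so
      the identity in the product, read at \<open>i\<close>, is the required one in
      \<open>J i\<close>.\<close>
    have "h x \<oplus>\<^bsub>J i\<^esub> k x i = h' x \<oplus>\<^bsub>J i\<^esub> k' x i" if "x \<in> carrier M" for x
      using fun_cong[OF bspec[OF a that], of i] i by (simp add: prod_semimodule_simps)
    with z i c[OF k(1)] c[OF k(2)]
    show "\<exists>k\<in>linear_maps S M (J i). \<exists>k'\<in>linear_maps S M (J i).
        (\<forall>x\<in>carrier L. k (f x) = \<zero>\<^bsub>J i\<^esub> \<and> k' (f x) = \<zero>\<^bsub>J i\<^esub>) \<and>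
        (\<forall>x\<in>carrier M. h x \<oplus>\<^bsub>J i\<^esub> k x = h' x \<oplus>\<^bsub>J i\<^esub> k' x)"
      by (intro bexI[of _ "\<lambda>x. k x i"] bexI[of _ "\<lambda>x. k' x i"]) (auto simp: prod_semimodule_simps)
  next
    fix u assume u: "u \<in> linear_maps S L (J i)"
    from hom_exact_extend[OF P e[OF u]]
    obtain h where h: "h \<in> linear_maps S M ?P" "\<forall>x\<in>carrier L. h (f x) = ?e u x"
      by (elim bexE)
    with i c[OF h(1)] show "\<exists>h\<in>linear_maps S M (J i). \<forall>x\<in>carrier L. h (f x) = u x"
      by (intro bexI[of _ "\<lambda>x. h x i"]) auto
  qed
next
  assume "\<forall>i\<in>\<Lambda>. hom_exact S L f M g N (J i)"
  then have P: "hom_exact S L f M g N (J i)" if "i \<in> \<Lambda>" for i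
    using that by blast
  note c = linear_maps_prod_component and ext = linear_maps_prod_ext
  show "hom_exact S L f M g N ?P"
    unfolding hom_exact_def
  proof (intro conjI ballI impI)
    fix h assume h: "h \<in> linear_maps S M ?P" "\<forall>x\<in>carrier L. h (f x) = \<zero>\<^bsub>?P\<^esub>"
    have "\<exists>u\<in>linear_maps S N (J i). \<forall>x\<in>carrier M. h x i = u (g x)" if i: "i \<in> \<Lambda>" for i
    proof -
      have "\<forall>x\<in>carrier L. h (f x) i = \<zero>\<^bsub>J i\<^esub>"
        using h(2) i by (simp add: prod_semimodule_simps)
      then show ?thesis by (rule hom_exact_factor[OF P[OF i] c[OF h(1) i]])
    qed
    \<comment> \<open>One factorization is chosen for every index; \<open>\<Lambda>\<close> is
      arbitrary, so this uses the axiom of choice.\<close>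
    then obtain u where u: "\<And>i. i \<in> \<Lambda> \<Longrightarrow> u i \<in> linear_maps S N (J i)"
      "\<And>i x. i \<in> \<Lambda> \<Longrightarrow> x \<in> carrier M \<Longrightarrow> h x i = u i (g x)" by metis
    show "\<exists>u\<in>linear_maps S N ?P. \<forall>x\<in>carrier M. h x = u (g x)"
    proof (intro bexI ballI)
      fix x assume x: "x \<in> carrier M"
      show "h x = (\<lambda>i\<in>\<Lambda>. u i (g x))"
        by (subst ext[OF h(1) x]) (simp add: restrict_eq_iff u(2) x)
    qed (rule linear_maps_prod_tuple[OF u(1)])
  next
    fix h h' assume h: "h \<in> linear_maps S M ?P" "h' \<in> linear_maps S M ?P"
      and eq: "\<forall>x\<in>carrier L. h (f x) = h' (f x)"
    have "\<exists>k\<in>linear_maps S M (J i). \<exists>k'\<in>linear_maps S M (J i).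
        (\<forall>x\<in>carrier L. k (f x) = \<zero>\<^bsub>J i\<^esub> \<and> k' (f x) = \<zero>\<^bsub>J i\<^esub>) \<and>
        (\<forall>x\<in>carrier M. h x i \<oplus>\<^bsub>J i\<^esub> k x = h' x i \<oplus>\<^bsub>J i\<^esub> k' x)" if i: "i \<in> \<Lambda>" for i
    proof -
      have "\<forall>x\<in>carrier L. h (f x) i = h' (f x) i" using eq by simp
      then show ?thesis by (rule hom_exact_normal[OF P[OF i] c[OF h(1) i] c[OF h(2) i]])
    qed
    \<comment> \<open>The correcting maps are likewise chosen for all indices at once and then
      tupled.\<close>
    then obtain k k' where k: "\<And>i. i \<in> \<Lambda> \<Longrightarrow> k i \<in> linear_maps S M (J i)"
        "\<And>i. i \<in> \<Lambda> \<Longrightarrow> k' i \<in> linear_maps S M (J i)"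
      and z: "\<And>i x. i \<in> \<Lambda> \<Longrightarrow> x \<in> carrier L \<Longrightarrow> k i (f x) = \<zero>\<^bsub>J i\<^esub> \<and> k' i (f x) = \<zero>\<^bsub>J i\<^esub>"
      and a: "\<And>i x. i \<in> \<Lambda> \<Longrightarrow> x \<in> carrier M \<Longrightarrow> h x i \<oplus>\<^bsub>J i\<^esub> k i x = h' x i \<oplus>\<^bsub>J i\<^esub> k' i x"
      by metis
    show "\<exists>k\<in>linear_maps S M ?P. \<exists>k'\<in>linear_maps S M ?P.
        (\<forall>x\<in>carrier L. k (f x) = \<zero>\<^bsub>?P\<^esub> \<and> k' (f x) = \<zero>\<^bsub>?P\<^esub>) \<and>
        (\<forall>x\<in>carrier M. h x \<oplus>\<^bsub>?P\<^esub> k x = h' x \<oplus>\<^bsub>?P\<^esub> k' x)"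
      using linear_maps_prod_tuple[OF k(1)] linear_maps_prod_tuple[OF k(2)]
      by (intro bexI[of _ "\<lambda>x. \<lambda>i\<in>\<Lambda>. k i x"] bexI[of _ "\<lambda>x. \<lambda>i\<in>\<Lambda>. k' i x"])
        (simp_all add: prod_semimodule_simps restrict_eq_iff z a)
  next
    fix u assume u: "u \<in> linear_maps S L ?P"
    have "\<exists>h\<in>linear_maps S M (J i). \<forall>x\<in>carrier L. h (f x) = u x i" if i: "i \<in> \<Lambda>" for i
      by (rule hom_exact_extend[OF P[OF i] c[OF u i]])
    then obtain h where h: "\<And>i. i \<in> \<Lambda> \<Longrightarrow> h i \<in> linear_maps S M (J i)"
      "\<And>i x. i \<in> \<Lambda> \<Longrightarrow> x \<in> carrier L \<Longrightarrow> h i (f x) = u x i" by metis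
    show "\<exists>h\<in>linear_maps S M ?P. \<forall>x\<in>carrier L. h (f x) = u x"
    proof (intro bexI ballI)
      fix x assume x: "x \<in> carrier L"
      show "(\<lambda>i\<in>\<Lambda>. h i (f x)) = u x"
        by (subst ext[OF u x]) (simp add: restrict_eq_iff h(2) x)
    qed (rule linear_maps_prod_tuple[OF h(1)])
  qed
qed

section \<open>From Hom sequences to e-injectivity\<close>

text \<open>The test sequences range over a class depending on \<open>S\<close> and \<open>M\<close>
  but not on \<open>J\<close>, so the product and its factors can be compared one sequence at a
  time.\<close>

lemma e_injective_iff_hom_exact:
  fixes M :: "('s, 'm, 'b) module_scheme"
  assumes "semimodule S M" "semimodule S J"
  shows "e_injective S M J \<longleftrightarrow>
    (\<forall>(L :: ('s, 'm) module) (N :: ('s, 'm) module) f g.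
      semimodule S L \<longrightarrow> semimodule S N \<longrightarrow>
      f \<in> linear_maps S L M \<longrightarrow> g \<in> linear_maps S M N \<longrightarrow> short_exact L f M g N \<longrightarrow>
      hom_exact S L f M g N J)"
  unfolding e_injective_def using short_exact_Hom_iff[OF _ assms(1) _ assms(2)] by blast

theorem proposition2p14:
  fixes S :: "('s, 'a) ring_scheme"
    and M :: "('s, 'm, 'b) module_scheme"
    and \<Lambda> :: "'i set"
    and J :: "'i \<Rightarrow> ('s, 'j, 'c) module_scheme"
  assumes "semiring S" and "\<zero>\<^bsub>S\<^esub> \<noteq> \<one>\<^bsub>S\<^esub>"
    and "semimodule S M"
    and "\<And>i. i \<in> \<Lambda> \<Longrightarrow> semimodule S (J i)"
  shows "e_injective S M (prod_semimodule \<Lambda> J) \<longleftrightarrow> (\<forall>i\<in>\<Lambda>. e_injective S M (J i))"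
proof -
  note M = assms(3) and J = assms(4)
  have hom: "hom_exact S L f M g N (prod_semimodule \<Lambda> J) \<longleftrightarrow>
      (\<forall>i\<in>\<Lambda>. hom_exact S L f M g N (J i))"
    for L N :: "('s, 'm) module" and f g
    using J by (rule hom_exact_prod_iff)
  have P: "semimodule S (prod_semimodule \<Lambda> J)"
    using assms(1) J by (rule semimodule_prod)
  show ?thesis
    unfolding e_injective_iff_hom_exact[OF M P]
    \<comment> \<open>\<open>ball_cong\<close> makes membership in \<open>\<Lambda>\<close>
      available for \<open>J\<close>, so each factor can be rewritten too. What remains is to
      exchange the quantifiers over indices and over sequences.\<close>
    by (simp add: hom e_injective_iff_hom_exact[OF M J] cong: ball_cong) blast
qed

end
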